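(* $m_g(2,5)=7$.
   Context: For a prime power $q$, $\mathbb{P}^2(\mathbb{F}_q)$ is the projective plane over the field $\mathbb{F}_q$ with $q$ elements. A conic is the zero set in $\mathbb{P}^2(\mathbb{F}_q)$ of a nonzero homogeneous quadratic form over $\mathbb{F}_q$; it may be reducible (e.g. a union of two lines). A generalized $k$-arc is a set of $k$ points of $\mathbb{P}^2(\mathbb{F}_q)$ such that no six of them lie on a (possibly reducible) conic. It is complete if it is not contained in a generalized $(k+1)$-arc. $m_g(2,q)$ is the size of the largest complete generalized $k$-arc in $\mathbb{P}^2(\mathbb{F}_q)$. *)

theory Defs
  imports "HOL-Analysis.Cartesian_Space"
begin

text \<open>
  The plane over a finite field: a point is a one-dimensional subspace of the
  coordinate space.
\<close>

definition proj_points :: "('a::{field,finite} ^ 3) set set"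
  where "proj_points = {P. vec.subspace P \<and> vec.dim P = 1}"

type_synonym 'a quad_coeffs = "'a \<times> 'a \<times> 'a \<times> 'a \<times> 'a \<times> 'a"

fun quad_form :: "'a::{field,finite} quad_coeffs \<Rightarrow> 'a ^ 3 \<Rightarrow> 'a"
  where "quad_form (a, b, c, d, e, f) v =
    a * (v $ 1)\<^sup>2 + b * (v $ 2)\<^sup>2 + c * (v $ 3)\<^sup>2 +
    d * (v $ 1 * v $ 2) + e * (v $ 1 * v $ 3) + f * (v $ 2 * v $ 3)"

text \<open>
  A form is nonzero when it is nonzero as a polynomial, that is, when some coefficient
  is nonzero. By homogeneity it vanishes at every vector of a point as soon as
  it vanishes at one nonzero vector.
\<close>

definition is_conic :: "('a::{field,finite} ^ 3) set set \<Rightarrow> bool"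
  where "is_conic C \<longleftrightarrow>
    (\<exists>q. q \<noteq> (0, 0, 0, 0, 0, 0) \<and> C = {P \<in> proj_points. \<forall>v\<in>P. quad_form q v = 0})"

definition generalized_arc :: "nat \<Rightarrow> ('a::{field,finite} ^ 3) set set \<Rightarrow> bool"
  where "generalized_arc k K \<longleftrightarrow>
    K \<subseteq> proj_points \<and> card K = k \<and>
    (\<forall>S\<subseteq>K. card S = 6 \<longrightarrow> \<not> (\<exists>C. is_conic C \<and> S \<subseteq> C))"

definition complete_generalized_arc :: "nat \<Rightarrow> ('a::{field,finite} ^ 3) set set \<Rightarrow> bool"
  where "complete_generalized_arc k K \<longleftrightarrow>
    generalized_arc k K \<and> \<not> (\<exists>K'. generalized_arc (k + 1) K' \<and> K \<subseteq> K')"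

text \<open>
  The type argument is the field of \<open>q\<close> elements. The maximum is over a nonempty
  finite set: the plane is finite, the empty set is an arc, and an arc of greatest
  size is complete.
\<close>

definition m_g :: "'a::{field,finite} itself \<Rightarrow> nat"
  where "m_g _ = Max {k. \<exists>K :: ('a ^ 3) set set. complete_generalized_arc k K}"

end

theory Submission
  imports Defs "HOL-Number_Theory.Residues"
begin

text \<open>
  Evaluating the quadratic forms at representatives of the points turns a set of points into a
  set of functionals on the six-dimensional space of forms, and a generalized arc is a set whose
  functionals are independent six at a time, that is, an arc for the Veronese embedding of the
  plane in projective 5-space.

  Upper bound. Take six points of an arc and the dual basis of forms, each of which vanishes at
  five of the six points. At two further points \<open>A\<close> and \<open>B\<close> no form of the
  dual basis vanishes, as its conic would contain a sixth point of the arc. So the ratio of its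
  values at \<open>A\<close> and \<open>B\<close> is a nonzero field element. A field with at most six elements has fewer than six of these,
  so two of the forms share their ratio. A combination of these two then vanishes at \<open>A\<close> and
  \<open>B\<close>, and at four of the six points: a conic through six points of the arc. Hence there is no
  arc of size eight (lemma \<open>generalized_arc_card_le_7\<close>).

  Lower bound. In an affine plane of characteristic not 2, a polynomial of degree at most 2 is determined by its values on
  the triangle of integer points \<open>(i, j)\<close> with \<open>i, j, 2 - i - j \<ge> 0\<close>. With
  \<open>k = 2 - i - j\<close>, its Lagrange basis there is \<open>(x choose i) (y choose j) (z choose k)\<close> where
  \<open>z = 2 - x - y\<close>. At \<open>(-1, -1)\<close> the third coordinate is \<open>4\<close>, and since
  \<open>(4 choose k)\<close> is \<open>(-1)^k\<close> modulo 5, every basis polynomial takes the value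
  \<open>(-1)^(i + j + k) = 1\<close>. So in characteristic 5 the value at
  \<open>(-1, -1)\<close> is the sum of the six values on the triangle
  (lemma \<open>quad_form_triangle_relation\<close>). As all coefficients of this
  relation are nonzero, a form that vanishes at six of the seven points vanishes at the seventh,
  hence on the whole triangle, and is zero. So the seven points are an arc, and by the upper bound
  it is complete.
\<close>

section \<open>Points and quadratic forms\<close>

lemma span_singleton_in_proj_points:
  fixes v :: "'a::{field,finite} ^ 3"
  assumes "v \<noteq> 0"
  shows "vec.span {v} \<in> proj_points"
  using assms by (simp add: proj_points_def)

lemma proj_point_generator:
  fixes P :: "('a::{field,finite} ^ 3) set"
  assumes "P \<in> proj_points"
  obtains v where "P = vec.span {v}"
proof -
  have sub: "vec.subspace P" and dim: "vec.dim P = 1"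
    using assms by (auto simp: proj_points_def)
  obtain B where B: "B \<subseteq> P" "vec.independent B" "P \<subseteq> vec.span B" "card B = vec.dim P"
    using vec.basis_exists[of P] by blast
  then obtain v where "B = {v}"
    using dim card_1_singletonE by metis
  then have "P = vec.span {v}"
    using B sub vec.span_minimal by blast
  then show thesis by (rule that)
qed

lemma quad_form_scale: "quad_form q (k *s v) = k\<^sup>2 * quad_form q v"
  by (cases q) (simp add: algebra_simps power2_eq_square)

lemma quad_form_vanishes_on_span_iff:
  "(\<forall>w\<in>vec.span {v}. quad_form q w = 0) \<longleftrightarrow> quad_form q v = 0"
  by (auto simp: vec.span_singleton quad_form_scale vec.span_base)

lemma quad_form_diff: "quad_form (q - q') v = quad_form q v - quad_form q' v"
  by (cases q; cases q') (simp add: algebra_simps)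

lemma quad_form_combination:
  "\<exists>q. \<forall>v. quad_form q v = s * quad_form p v + t * quad_form p' v"
proof -
  obtain a b c d e f where 1: "p = (a, b, c, d, e, f)" by (cases p)
  obtain a' b' c' d' e' f' where 2: "p' = (a', b', c', d', e', f')" by (cases p')
  have "quad_form (s * a + t * a', s * b + t * b', s * c + t * c',
      s * d + t * d', s * e + t * e', s * f + t * f') v
    = s * quad_form p v + t * quad_form p' v" for v
    by (simp add: 1 2 algebra_simps)
  then show ?thesis by blast
qed

text \<open>
  The condition that defines a generalized arc, in terms of vectors: the evaluation functionals of
  any six points have no common zero other than the zero form.
\<close>

lemma generalized_arc_iff_quad_form_zero:
  fixes r :: "('a::{field,finite} ^ 3) set \<Rightarrow> 'a ^ 3"
  assumes "K \<subseteq> proj_points" and r: "\<And>P. P \<in> K \<Longrightarrow> P = vec.span {r P}"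
  shows "generalized_arc k K \<longleftrightarrow> card K = k \<and>
    (\<forall>S\<subseteq>K. card S = 6 \<longrightarrow> (\<forall>q. (\<forall>P\<in>S. quad_form q (r P) = 0) \<longrightarrow> q = 0))"
proof -
  have no_conic_iff: "\<not> (\<exists>C. is_conic C \<and> S \<subseteq> C) \<longleftrightarrow>
      (\<forall>q. (\<forall>P\<in>S. quad_form q (r P) = 0) \<longrightarrow> q = 0)"
    if "S \<subseteq> K" for S
  proof -
    have "(\<forall>v\<in>P. quad_form q v = 0) \<longleftrightarrow> quad_form q (r P) = 0" if "P \<in> S" for P q
      using r[of P] quad_form_vanishes_on_span_iff[of "r P" q] \<open>S \<subseteq> K\<close> that by auto
    then have in_conic_iff: "S \<subseteq> {P \<in> proj_points. \<forall>v\<in>P. quad_form q v = 0}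
        \<longleftrightarrow> (\<forall>P\<in>S. quad_form q (r P) = 0)" for q
      using \<open>S \<subseteq> K\<close> assms(1) by blast
    have zero: "(0, 0, 0, 0, 0, 0) = (0 :: 'a quad_coeffs)"
      by (simp add: zero_prod_def)
    have "\<not> (\<exists>C. is_conic C \<and> S \<subseteq> C) \<longleftrightarrow>
        (\<forall>q. S \<subseteq> {P \<in> proj_points. \<forall>v\<in>P. quad_form q v = 0} \<longrightarrow> q = 0)"
      unfolding is_conic_def zero by blast
    then show ?thesis unfolding in_conic_iff .
  qed
  show ?thesis
    unfolding generalized_arc_def
    by (simp only: assms(1) no_conic_iff simp_thms cong: imp_cong)
qed

section \<open>The upper bound\<close>

text \<open>
  Six independent functionals on the six-dimensional space of forms are a basis of the dual space.
  Over a finite field this is a count: evaluation is an injective map between sets of the same size.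
\<close>

lemma quad_form_interpolation:
  fixes r :: "'b \<Rightarrow> 'a::{field,finite} ^ 3"
  assumes "card S = 6"
    and zero: "\<And>q. (\<forall>P\<in>S. quad_form q (r P) = 0) \<Longrightarrow> q = 0"
  obtains q where "\<And>P. P \<in> S \<Longrightarrow> quad_form q (r P) = g P"
proof -
  have [simp]: "finite S" using assms(1) card.infinite by fastforce
  define ev where "ev = (\<lambda>q. restrict (\<lambda>P. quad_form q (r P)) S)"
  have "inj ev"
  proof (rule injI)
    fix q q' assume "ev q = ev q'"
    then have "quad_form q (r P) = quad_form q' (r P)" if "P \<in> S" for P
      using that by (metis ev_def restrict_apply')
    then show "q = q'"
      using zero[of "q - q'"] by (simp add: quad_form_diff)
  qed
  then have "card (range ev) = CARD('a) ^ 6"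
    by (simp add: card_image eval_nat_numeral)
  moreover have "card (S \<rightarrow>\<^sub>E (UNIV :: 'a set)) = CARD('a) ^ 6"
    by (simp add: card_PiE assms(1))
  moreover have "range ev \<subseteq> S \<rightarrow>\<^sub>E UNIV"
    by (auto simp: ev_def)
  ultimately have "range ev = S \<rightarrow>\<^sub>E UNIV"
    by (intro card_subset_eq) (auto intro: finite_PiE)
  then have "restrict g S \<in> range ev" by auto
  then obtain q where "restrict g S = ev q" by auto
  then have "quad_form q (r P) = g P" if "P \<in> S" for P
    using that by (metis ev_def restrict_apply')
  then show thesis by (rule that)
qed

theorem generalized_arc_card_le_7:
  fixes K :: "('a::{field,finite} ^ 3) set set"
  assumes "CARD('a) \<le> 6" and arc: "generalized_arc k K"
  shows "k \<le> 7"
proof (rule ccontr)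
  assume "\<not> k \<le> 7"
  have K: "K \<subseteq> proj_points" and card_K: "card K = k"
    using arc by (auto simp: generalized_arc_def)
  have "\<forall>P\<in>K. \<exists>v. P = vec.span {v}"
    using K proj_point_generator by (metis subsetD)
  then obtain r where r: "\<And>P. P \<in> K \<Longrightarrow> P = vec.span {r P}"
    by metis
  have no_conic: "q = 0" if "S \<subseteq> K" "card S = 6" "\<And>P. P \<in> S \<Longrightarrow> quad_form q (r P) = 0" for S q
    using iffD1[OF generalized_arc_iff_quad_form_zero[OF K r] arc] that by blast
  obtain T where "T \<subseteq> K" "card T = 8"
    using obtain_subset_with_card_n[of 8 K] card_K \<open>\<not> k \<le> 7\<close> by auto
  obtain S where S: "S \<subseteq> T" "card S = 6" "finite S"
    using obtain_subset_with_card_n[of 6 T] \<open>card T = 8\<close> by auto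
  have "card (T - S) = 2"
    using S \<open>card T = 8\<close> by (simp add: card_Diff_subset)
  then obtain A B where AB: "T - S = {A, B}" "A \<noteq> B"
    by (auto simp: card_2_iff)
  have in_K: "S \<subseteq> K" "A \<in> K" "B \<in> K" and notin_S: "A \<notin> S" "B \<notin> S"
    using AB S \<open>T \<subseteq> K\<close> by auto
  \<comment> \<open>The forms \<open>L P\<close> are the basis dual to evaluation at the points of \<open>S\<close>.\<close>
  have "\<exists>q. \<forall>P'\<in>S. quad_form q (r P') = (if P' = P then 1 else 0)" for P
    using quad_form_interpolation[OF S(2), of r "\<lambda>P'. if P' = P then 1 else 0"]
      no_conic[OF \<open>S \<subseteq> K\<close> S(2)] by metis
  then obtain L where L: "\<And>P P'. P' \<in> S \<Longrightarrow> quad_form (L P) (r P') = (if P' = P then 1 else 0)"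
    by metis
  have nonzero: "quad_form (L P) (r X) \<noteq> 0" if "P \<in> S" "X \<in> {A, B}" for P X
  proof
    assume "quad_form (L P) (r X) = 0"
    then have "quad_form (L P) (r Y) = 0" if "Y \<in> insert X (S - {P})" for Y
      using that L by (metis DiffE insertE singletonI)
    moreover have "insert X (S - {P}) \<subseteq> K" "card (insert X (S - {P})) = 6"
      using that in_K notin_S S by auto
    ultimately have "L P = 0"
      using no_conic[of "insert X (S - {P})" "L P"] by blast
    moreover have "quad_form (L P) (r P) = 1" using L that by simp
    ultimately show False by (simp add: zero_prod_def)
  qed
  let ?ratio = "\<lambda>P. quad_form (L P) (r A) / quad_form (L P) (r B)"
  have "\<not> inj_on ?ratio S"
  proof (rule pigeonhole)
    have "?ratio ` S \<subseteq> UNIV - {0}" using nonzero by auto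
    then have "card (?ratio ` S) \<le> card (UNIV - {0 :: 'a})" by (intro card_mono) auto
    also have "\<dots> < card S" using assms(1) S by (simp add: card_Diff_singleton)
    finally show "card (?ratio ` S) < card S" .
  qed
  then obtain P P' where P: "P \<in> S" "P' \<in> S" "P \<noteq> P'" and ratio: "?ratio P = ?ratio P'"
    by (auto simp: inj_on_def)
  \<comment> \<open>The coefficients make the combination vanish at \<open>A\<close>; equality of the ratios makes it
    vanish at \<open>B\<close> as well.\<close>
  obtain q where q: "\<And>v. quad_form q v =
      quad_form (L P) (r A) * quad_form (L P') v + (- quad_form (L P') (r A)) * quad_form (L P) v"
    using quad_form_combination by blast
  let ?S = "insert A (insert B (S - {P, P'}))"
  have "?S \<subseteq> K" using in_K by auto
  moreover have "card ?S = 6"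
    using P S AB notin_S by (simp add: card_Diff_subset)
  moreover have "quad_form q (r X) = 0" if "X \<in> ?S" for X
  proof -
    consider "X = A" | "X = B" | "X \<in> S" "X \<noteq> P" "X \<noteq> P'"
      using \<open>X \<in> ?S\<close> by blast
    then show ?thesis
    proof cases
      case 1
      then show ?thesis by (simp add: q)
    next
      case 2
      then show ?thesis using ratio nonzero P by (simp add: q field_simps)
    next
      case 3
      then show ?thesis using L by (simp add: q)
    qed
  qed
  ultimately have "q = 0" using no_conic by blast
  then have "quad_form q (r P') = 0" by (simp add: zero_prod_def)
  then show False using nonzero P L by (simp add: q)
qed

section \<open>Seven points over the field of five elements\<close>

definition affine_point :: "'a::{field,finite} \<times> 'a \<Rightarrow> ('a ^ 3) set"
  where "affine_point p = vec.span {vector [fst p, snd p, 1]}"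

definition triangle_points :: "('a::{field,finite} \<times> 'a) set"
  where "triangle_points = {(0, 0), (1, 0), (2, 0), (0, 1), (0, 2), (1, 1)}"

lemma affine_point_in_proj_points: "affine_point p \<in> proj_points"
proof -
  have "vector [fst p, snd p, 1] \<noteq> (0 :: 'a ^ 3)"
    by (metis vector_3(3) zero_index zero_neq_one)
  then show ?thesis
    by (simp add: affine_point_def span_singleton_in_proj_points)
qed

lemma inj_affine_point: "inj affine_point"
proof (rule injI)
  fix p p' :: "'a \<times> 'a"
  assume "affine_point p = affine_point p'"
  then have "vector [fst p, snd p, 1] \<in> vec.span {vector [fst p', snd p', 1] :: 'a ^ 3}"
    by (metis affine_point_def singletonI vec.span_base)
  then obtain k where k: "vector [fst p, snd p, 1] = k *s (vector [fst p', snd p', 1] :: 'a ^ 3)"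
    by (auto simp: vec.span_singleton)
  have "1 = k" using arg_cong[OF k, of "\<lambda>v. v $ 3"] by simp
  then show "p = p'"
    using arg_cong[OF k, of "\<lambda>v. v $ 1"] arg_cong[OF k, of "\<lambda>v. v $ 2"] by (simp add: prod_eq_iff)
qed

lemma five_eq_zero:
  assumes "CARD('a::{field,finite}) = 5"
  shows "(5 :: 'a) = 0"
proof -
  have "CHAR('a) dvd 5" using CHAR_dvd_CARD[where 'a = 'a] assms by simp
  then have "of_nat 5 = (0 :: 'a)" by (simp only: of_nat_eq_0_iff_char_dvd)
  then show ?thesis by simp
qed

lemma quad_form_zero_if_zero_on_triangle:
  fixes q :: "'a::{field,finite} quad_coeffs"
  assumes two: "(2 :: 'a) \<noteq> 0"
    and zero: "\<And>p. p \<in> triangle_points \<Longrightarrow> quad_form q (vector [fst p, snd p, 1]) = 0"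
  shows "q = 0"
proof -
  obtain a b c d e f where q: "q = (a, b, c, d, e, f)" by (cases q)
  have c: "c = 0" and "a + e = 0" "b + f = 0" "4 * a + 2 * e = 0" "4 * b + 2 * f = 0"
    and d: "a + b + d + e + f = 0"
    using zero[of "(0, 0)"] zero[of "(1, 0)"] zero[of "(0, 1)"] zero[of "(2, 0)"]
      zero[of "(0, 2)"] zero[of "(1, 1)"]
    by (auto simp: triangle_points_def q algebra_simps)
  have "2 * a = (4 * a + 2 * e) - 2 * (a + e)" "2 * b = (4 * b + 2 * f) - 2 * (b + f)"
    by (simp_all add: algebra_simps)
  then have "a = 0" "b = 0"
    using \<open>a + e = 0\<close> \<open>b + f = 0\<close> \<open>4 * a + 2 * e = 0\<close> \<open>4 * b + 2 * f = 0\<close> two by simp_all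
  then show ?thesis
    using \<open>a + e = 0\<close> \<open>b + f = 0\<close> c d by (simp add: q zero_prod_def)
qed

lemma triangle_points_distinct:
  assumes "(2 :: 'a::{field,finite}) \<noteq> 0"
  shows "card (triangle_points :: ('a \<times> 'a) set) = 6"
    and "(- 1, - 1) \<notin> (triangle_points :: ('a \<times> 'a) set)"
proof -
  have "(2 :: 'a) \<noteq> 1" "(1 :: 'a) \<noteq> 2" by (metis add_cancel_right_right one_add_one zero_neq_one)+
  moreover have "(- 1 :: 'a) \<noteq> 1" using assms by (metis add.right_inverse one_add_one)
  ultimately show "card (triangle_points :: ('a \<times> 'a) set) = 6"
    and "(- 1, - 1) \<notin> (triangle_points :: ('a \<times> 'a) set)"
    using assms assms[symmetric] by (simp_all add: triangle_points_def)
qed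

text \<open>
  Lagrange extrapolation from the triangle to \<open>(-1, -1)\<close>, whose coefficients
  \<open>(-1)^(i + j) (4 choose k)\<close> are all 1 modulo 5. On the monomials, the two sides
  differ by multiples of 5.
\<close>

lemma quad_form_triangle_relation:
  fixes q :: "'a::{field,finite} quad_coeffs"
  assumes five: "(5 :: 'a) = 0" and two: "(2 :: 'a) \<noteq> 0"
  shows "(\<Sum>p\<in>triangle_points. quad_form q (vector [fst p, snd p, 1]))
    = quad_form q (vector [- 1, - 1, 1])"
proof -
  obtain a b c d e f where q: "q = (a, b, c, d, e, f)" by (cases q)
  have "(2 :: 'a) \<noteq> 1" "(1 :: 'a) \<noteq> 2" by (metis add_cancel_right_right one_add_one zero_neq_one)+
  then have "(\<Sum>p\<in>triangle_points. quad_form q (vector [fst p, snd p, 1]))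
    = quad_form q (vector [- 1, - 1, 1]) + 5 * (a + b + c + e + f)"
    using two two[symmetric] by (simp add: triangle_points_def q algebra_simps)
  then show ?thesis using five by simp
qed

text \<open>
  Every subset of six points determines the form: if it omits a point of the triangle, the relation
  gives the value there.
\<close>

lemma generalized_arc_triangle:
  assumes five: "(5 :: 'a::{field,finite}) = 0"
  shows "generalized_arc 7
    (affine_point ` insert (- 1, - 1) triangle_points :: ('a ^ 3) set set)"
proof -
  let ?X = "insert (- 1, - 1) triangle_points :: ('a \<times> 'a) set"
  let ?v = "\<lambda>p. vector [fst p, snd p, 1] :: 'a ^ 3"
  have two: "(2 :: 'a) \<noteq> 0"
  proof
    assume "(2 :: 'a) = 0"
    moreover have "(5 :: 'a) = 2 * 2 + 1" by simp
    ultimately show False using five by simp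
  qed
  have fin: "finite (triangle_points :: ('a \<times> 'a) set)" by (simp add: triangle_points_def)
  have inj: "inj_on affine_point ?X" using inj_affine_point by (rule inj_on_subset) simp
  have card: "card (affine_point ` ?X) = 7"
    unfolding card_image[OF inj] using triangle_points_distinct[OF two] fin by simp
  define r where "r P = ?v (inv_into UNIV affine_point P)" for P
  have r: "r (affine_point p) = ?v p" for p
    by (simp add: r_def inv_f_f[OF inj_affine_point])
  have "q = 0" if S: "S \<subseteq> affine_point ` ?X" "card S = 6" and zero: "\<forall>P\<in>S. quad_form q (r P) = 0"
    for S q
  proof (rule quad_form_zero_if_zero_on_triangle[OF two])
    have "card (affine_point ` ?X - S) = 1"
      using S card fin by (simp add: card_Diff_subset finite_subset)
    then obtain P where P: "affine_point ` ?X - S = {P}"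
      by (rule card_1_singletonE)
    then have "P \<in> affine_point ` ?X" by blast
    then obtain p where p: "P = affine_point p" "p \<in> ?X" by (rule imageE)
    then have others: "quad_form q (?v x) = 0" if "x \<in> ?X" "x \<noteq> p" for x
      using that P p zero inj_affine_point by (metis Diff_iff image_eqI injD r singletonD)
    have "quad_form q (?v p) = 0"
    proof (cases "p \<in> triangle_points")
      case True
      have "(\<Sum>x\<in>triangle_points. quad_form q (?v x))
          = quad_form q (?v p) + (\<Sum>x\<in>triangle_points - {p}. quad_form q (?v x))"
        using fin True by (rule sum.remove)
      also have "(\<Sum>x\<in>triangle_points - {p}. quad_form q (?v x)) = 0"
        using others by (intro sum.neutral) auto
      finally have "quad_form q (?v p) = quad_form q (?v (- 1, - 1))"
        using quad_form_triangle_relation[OF five two, of q] by simp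
      also have "\<dots> = 0"
        using True triangle_points_distinct(2)[OF two] by (intro others) auto
      finally show ?thesis .
    next
      case False
      then have "p = (- 1, - 1)" using p by simp
      moreover have "(\<Sum>x\<in>triangle_points. quad_form q (?v x)) = 0"
        using others False by (intro sum.neutral) auto
      ultimately show ?thesis
        using quad_form_triangle_relation[OF five two, of q] by simp
    qed
    then show "quad_form q (?v x) = 0" if "x \<in> triangle_points" for x
      using others that by (cases "x = p") auto
  qed
  moreover have "P = vec.span {r P}" if "P \<in> affine_point ` ?X" for P
    using that r affine_point_def by (metis imageE)
  ultimately show ?thesis
    using card affine_point_in_proj_points
    by (subst generalized_arc_iff_quad_form_zero[where r = r]) blast+
qed

theorem proposition5:
  assumes "CARD('a::{field,finite}) = 5"
  shows "m_g TYPE('a) = 7"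
proof -
  let ?sizes = "{k. \<exists>K :: ('a ^ 3) set set. complete_generalized_arc k K}"
  have bound: "k \<le> 7" if "generalized_arc k K" for k and K :: "('a ^ 3) set set"
    using generalized_arc_card_le_7[OF _ that] assms by simp
  have "Max ?sizes = 7"
  proof (rule Max_eqI)
    show le: "k \<le> 7" if "k \<in> ?sizes" for k
      using that bound by (auto simp: complete_generalized_arc_def)
    show "finite ?sizes"
      by (rule finite_subset[of _ "{..7}"]) (use le in auto)
    show "7 \<in> ?sizes"
      using generalized_arc_triangle[OF five_eq_zero[OF assms]] bound[of "7 + 1"]
      by (auto simp: complete_generalized_arc_def)
  qed
  then show ?thesis by (simp add: m_g_def)
qed

end
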